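(* The set of all pairs of integers $(x,y)\in\mathbb{Z}^2$ satisfying $y^2(2x+1)+y(x+2)-3x(x+1)=0$ is $$\{(0,0),\,(-1,1),\,(1,-2),\,(1,1),\,(-1,0),\,(0,-2)\}.$$ *)

theory Defs
  imports Main
begin

end

theory Submission
  imports Defs
begin

text \<open>
  For fixed \<open>y\<close> the equation is the quadratic \<open>3x\<^sup>2 - (2y\<^sup>2 + y - 3)x - (y\<^sup>2 + 2y) = 0\<close>
  in \<open>x\<close>, so its discriminant has to be a perfect square. That discriminant is
  \<open>(2y\<^sup>2 + y)\<^sup>2 + 9(2y + 1)\<close>: a square perturbed by a term that is linear in \<open>y\<close>
  and, being odd, never zero. Distinct squares near \<open>m\<^sup>2\<close> are at least about \<open>2\<bar>m\<bar>\<close> apart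
  (\<open>square_gap\<close>), which is here quadratic in \<open>y\<close>, so \<open>y\<close> is bounded. This is the simplest case
  of Runge's method. A bound on \<open>y\<close> bounds the discriminant and hence \<open>x\<close>, and the
  finitely many remaining pairs are inspected.
\<close>

text \<open>
  The square closest to \<open>m\<^sup>2\<close> without being equal to it is \<open>(\<bar>m\<bar> - 1)\<^sup>2\<close> for
  \<open>m \<noteq> 0\<close>, and it lies at distance \<open>2\<bar>m\<bar> - 1\<close>.
\<close>
lemma square_gap:
  fixes z m :: int
  assumes "z\<^sup>2 \<noteq> m\<^sup>2"
  shows "2 * \<bar>m\<bar> - 1 \<le> \<bar>z\<^sup>2 - m\<^sup>2\<bar>"
proof -
  have "\<bar>z\<bar> \<noteq> \<bar>m\<bar>"
    using assms power2_eq_iff[of z m] by (auto simp: abs_eq_iff)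
  then consider "\<bar>z\<bar> + 1 \<le> \<bar>m\<bar>" | "\<bar>m\<bar> + 1 \<le> \<bar>z\<bar>" by linarith
  then show ?thesis
  proof cases
    case 1
    then have "\<bar>z\<bar>\<^sup>2 \<le> (\<bar>m\<bar> - 1)\<^sup>2" by (intro power_mono) auto
    then show ?thesis by (simp add: power2_diff)
  next
    case 2
    then have "(\<bar>m\<bar> + 1)\<^sup>2 \<le> \<bar>z\<bar>\<^sup>2" by (intro power_mono) auto
    then show ?thesis by (simp add: power2_sum)
  qed
qed

text \<open>
  The left-hand square is \<open>(6x - (2y\<^sup>2 + y - 3))\<^sup>2\<close>, obtained by completing the square in \<open>x\<close>.
\<close>
lemma discriminant_eq:
  fixes x y :: int
  assumes "y^2 * (2*x + 1) + y * (x + 2) - 3*x * (x + 1) = 0"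
  shows "(6*x - 2*y\<^sup>2 - y + 3)\<^sup>2 = (2*y\<^sup>2 + y)\<^sup>2 + 9 * (2*y + 1)"
proof -
  have "(6*x - 2*y\<^sup>2 - y + 3)\<^sup>2 = (2*y\<^sup>2 + y)\<^sup>2 + 9 * (2*y + 1)
      - 12 * (y^2 * (2*x + 1) + y * (x + 2) - 3*x * (x + 1))"
    by (simp add: power2_eq_square algebra_simps)
  then show ?thesis using assms by simp
qed

lemma solution_y_bound:
  fixes x y :: int
  assumes "y^2 * (2*x + 1) + y * (x + 2) - 3*x * (x + 1) = 0"
  shows "y \<in> {-4..4}"
proof (rule ccontr)
  assume "y \<notin> {-4..4}"
  then consider "y \<ge> 5" | "y \<le> -5" by force
  note far = this
  let ?z = "6*x - 2*y\<^sup>2 - y + 3" and ?m = "2*y\<^sup>2 + y"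
  have diff: "?z\<^sup>2 - ?m\<^sup>2 = 9 * (2*y + 1)"
    using discriminant_eq[OF assms] by simp
  have "9 * (2*y + 1) \<noteq> 0" by presburger
  with diff have "?z\<^sup>2 \<noteq> ?m\<^sup>2" by linarith
  from square_gap[OF this] have "2 * \<bar>?m\<bar> - 1 \<le> \<bar>9 * (2*y + 1)\<bar>"
    unfolding diff .
  then have gap: "2 * ?m - 1 \<le> \<bar>9 * (2*y + 1)\<bar>"
    using abs_ge_self[of ?m] by (meson diff_right_mono mult_left_mono order_trans zero_le_numeral)
  from far show False
  proof cases
    case 1
    then have "5 * y \<le> y\<^sup>2" by (simp add: power2_eq_square)
    moreover have "2 * ?m - 1 \<le> 9 * (2*y + 1)" using gap 1 by simp
    ultimately show False using 1 by (simp add: algebra_simps)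
  next
    case 2
    then have "-5 * y \<le> y\<^sup>2"
      using mult_right_mono_neg[of y "-5" y] by (simp add: power2_eq_square)
    moreover have "2 * ?m - 1 \<le> - (9 * (2*y + 1))" using gap 2 by simp
    ultimately show False using 2 by (simp add: algebra_simps)
  qed
qed

text \<open>
  For \<open>\<bar>y\<bar> \<le> 4\<close> the discriminant is at most \<open>36\<^sup>2 + 81 < 38\<^sup>2\<close>, so
  \<open>6x\<close> lies within \<open>37\<close> of \<open>2y\<^sup>2 + y - 3\<close>, a number between \<open>-3\<close> and \<open>33\<close>.
\<close>
lemma solution_x_bound:
  fixes x y :: int
  assumes "y^2 * (2*x + 1) + y * (x + 2) - 3*x * (x + 1) = 0"
  shows "x \<in> {-6..11}"
proof -
  let ?z = "6*x - 2*y\<^sup>2 - y + 3"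
  have y: "-4 \<le> y" "y \<le> 4"
    using solution_y_bound[OF assms] by auto
  have "\<bar>y\<bar> \<le> \<bar>4\<bar>" using y by linarith
  then have "y\<^sup>2 \<le> 4\<^sup>2" by (simp only: abs_le_square_iff)
  then have upper: "2*y\<^sup>2 + y \<le> 36" using y by simp
  have "0 \<le> y * (2*y + 1)" by (simp add: zero_le_mult_iff) linarith
  then have lower: "0 \<le> 2*y\<^sup>2 + y" by (simp add: power2_eq_square algebra_simps)
  have "(2*y\<^sup>2 + y)\<^sup>2 \<le> 36\<^sup>2" using upper lower by (rule power_mono)
  then have "?z\<^sup>2 < 38\<^sup>2"
    using discriminant_eq[OF assms] y by simp
  then have "\<bar>?z\<bar> < 38" using power2_less_imp_less[of "\<bar>?z\<bar>" 38] by simp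
  then show ?thesis using lower upper by (simp add: abs_less_iff)
qed

theorem theorem4p1:
  shows "{(x :: int, y :: int). y^2 * (2*x + 1) + y * (x + 2) - 3*x * (x + 1) = 0}
    = {(0, 0), (-1, 1), (1, -2), (1, 1), (-1, 0), (0, -2)}"
    (is "?S = ?T")
proof
  show "?T \<subseteq> ?S" by auto
  have "\<forall>y \<in> {-4..4}. \<forall>x \<in> {-6..11}.
      y^2 * (2*x + 1) + y * (x + 2) - 3*x * (x + 1) = 0 \<longrightarrow> (x, y) \<in> ?T"
    by (simp add: simp_from_to)
  then show "?S \<subseteq> ?T"
    using solution_x_bound solution_y_bound by blast
qed

end
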